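(* Let $p$ be a (regular) S-pair among the basis elements $e_1,\dots,e_n$ of an extension $\mathcal G_n$, and let $p'$ be the result of regular reducing $p$. Let $M$ be the finite set $$M:=\{ae_i : a \text{ is a monomial and } \mathfrak s(ae_i)=\mathfrak s(p)\}.$$ Then all elements of $M$ regular reduce to $p'$ (i.e. for every element of $M$, the result $r$ of regular reducing it satisfies $\overline r=\overline{p'}$). Also, $p'$ is singular top reducible if and only if some element of $M$ is regular top reduced.
   Context: Let $R$ be a polynomial ring over a field and $\mathcal G=\{g_1,\dots,g_m\}$ a finite indexed set of nonzero polynomials of $R$. A monomial is a polynomial with exactly one term (its coefficient need not be 1). Let $e_1,\dots,e_m$ be the standard basis of $R^m$ and $\overline u:=\sum_{i=1}^m u_ig_i$ for $u\in R^m$. Let $\le$ denote two term orders, one on $R$ and one on $R^m$; they ignore coefficients, satisfy $0<t$ for all terms $t$, and are compatible: $a\le b\iff ae_i\le be_i$ for all monomials $a,b$ and $1\le i\le m$. For terms, $a\simeq b$ means $a=sb$ with $s$ a nonzero field element. $\operatorname{in}(f)$ is the $\le$-maximal term of $f\in R$ (coefficient included), with $\operatorname{in}(0)=0$. For $u\in R^m$ the signature $\mathfrak s(u)$ is the $\le$-maximal term of $u$ (coefficient included), with $\mathfrak s(0)=0$. An extension $\mathcal G_n=\{g_1,\dots,g_n\}$, $n\ge m$, consists of $g_1,\dots,g_m$ and additional nonzero polynomials $g_{m+1},\dots,g_n$ of the ideal $\langle\mathcal G\rangle$, together with an $R$-module homomorphism $\phi:R^n\to R^m$ with $\phi(e_i)=e_i$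 for $i\le m$ and $\overline u=\overline{\phi(u)}$ for all $u\in R^n$, where now $e_1,\dots,e_n$ is the standard basis of $R^n$ and $\overline u:=\sum_{i=1}^n u_ig_i$ for $u\in R^n$. For $u\in R^n$ put $\mathfrak s(u):=\mathfrak s(\phi(u))$. In the definition of $M$ the index $i$ ranges over $1,\dots,n$. Reduction. For $u\in R^n$ and a monomial $a$, $ae_i$ reduces a term $t$ of $\overline u$ if $\operatorname{in}(\overline{ae_i})=t$ and $\mathfrak s(ae_i)\le\mathfrak s(u)$; the outcome of the step is $u-ae_i$. The step is singular if $\mathfrak s(ae_i)\simeq\mathfrak s(u)$ and regular if $\mathfrak s(ae_i)<\mathfrak s(u)$. An element is regular reduced if no term of its image in $R$ can be reduced by a regular step. It is regular top reducible if the lead term of its (nonzero) image can be reduced by a regular step, and regular top reduced otherwise. It is singular top reducible if the lead term of its (nonzero) image can be reduced by a singular step. The result of regular reducing $u$ is obtained by performing regular steps until the element is regular reduced; regular steps preserve the signature, including its coefficient. S-pairs. With $d=\gcd(\operatorname{in}(g_i),\operatorname{in}(g_j))$, the S-pair between $e_i$ and $e_j$ is $\mathcal S(i,j):=\frac{\operatorname{in}(g_j)}{d}e_i-\frac{\operatorname{in}(g_i)}{d}e_j$; it is singular if the signatures of its two summands are related by $\simeq$, and regular otherwise. "S-pair" always means regular S-pair.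
   Formalization: The formal theorem additionally assumes that every u in R^n with s(u) < s(p) reduces to zero (its image becomes 0 after finitely many regular or singular steps); for an arbitrary extension the claim is false. *)

theory Defs
  imports Complex_Main "HOL-Library.Poly_Mapping"
begin

text \<open>Polynomials in the variables \<open>'x\<close> over \<open>'k\<close> are finitely supported maps from exponent
  vectors to coefficients. A vector of R^n is a finitely supported map
  from indices to polynomials whose support is contained in \<open>{1..n}\<close>, so that R^m is a subset of
  R^n for \<open>m \<le> n\<close>, and \<open>Poly_Mapping.single i a\<close> is the vector \<open>a e\<^sub>i\<close>.\<close>

type_synonym 'x pp = "'x \<Rightarrow>\<^sub>0 nat"
type_synonym ('x, 'k) mpoly = "('x \<Rightarrow>\<^sub>0 nat) \<Rightarrow>\<^sub>0 'k"
type_synonym ('x, 'k) mvec = "nat \<Rightarrow>\<^sub>0 (('x \<Rightarrow>\<^sub>0 nat) \<Rightarrow>\<^sub>0 'k)"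

definition free_mod :: "nat \<Rightarrow> ('x, 'k::field) mvec set" where
  "free_mod n = {u. Poly_Mapping.keys u \<subseteq> {1..n}}"

definition vscale :: "('x, 'k::field) mpoly \<Rightarrow> ('x, 'k) mvec \<Rightarrow> ('x, 'k) mvec" where
  "vscale a u = Poly_Mapping.map ((*) a) u"

definition is_monomial :: "('x, 'k::field) mpoly \<Rightarrow> bool" where
  "is_monomial a \<longleftrightarrow> (\<exists>t c. c \<noteq> 0 \<and> a = Poly_Mapping.single t c)"

definition bar :: "nat \<Rightarrow> (nat \<Rightarrow> ('x, 'k::field) mpoly) \<Rightarrow> ('x, 'k) mvec \<Rightarrow> ('x, 'k) mpoly" where
  "bar n g u = (\<Sum>i\<in>{1..n}. Poly_Mapping.lookup u i * g i)"


subsection \<open>Term orders, lead terms and signatures\<close>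

text \<open>Term orders ignore coefficients, so they are given as relations on exponent vectors and
  on pairs \<open>(t, i)\<close>, the latter standing for \<open>t e\<^sub>i\<close>.\<close>

definition term_order :: "'x pp rel \<Rightarrow> bool" where
  "term_order le \<longleftrightarrow> linear_order_on UNIV le
     \<and> (\<forall>t. (0, t) \<in> le)
     \<and> (\<forall>s t v. (s, t) \<in> le \<longrightarrow> (v + s, v + t) \<in> le)"

definition module_term_order :: "nat \<Rightarrow> ('x pp \<times> nat) rel \<Rightarrow> bool" where
  "module_term_order m lem \<longleftrightarrow> linear_order_on (UNIV \<times> {1..m}) lem
     \<and> (\<forall>t. \<forall>i\<in>{1..m}. ((0, i), (t, i)) \<in> lem)
     \<and> (\<forall>s i t j v. ((s, i), (t, j)) \<in> lem \<longrightarrow> ((v + s, i), (v + t, j)) \<in> lem)"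

definition compatible_orders :: "nat \<Rightarrow> 'x pp rel \<Rightarrow> ('x pp \<times> nat) rel \<Rightarrow> bool" where
  "compatible_orders m le lem \<longleftrightarrow>
     (\<forall>s t. \<forall>i\<in>{1..m}. (s, t) \<in> le \<longleftrightarrow> ((s, i), (t, i)) \<in> lem)"

definition greatest_in :: "'a rel \<Rightarrow> 'a set \<Rightarrow> 'a" where
  "greatest_in r A = (THE x. x \<in> A \<and> (\<forall>y\<in>A. (y, x) \<in> r))"

definition lead_term :: "'x pp rel \<Rightarrow> ('x, 'k::field) mpoly \<Rightarrow> ('x, 'k) mpoly" where
  "lead_term le f = (if f = 0 then 0 else
     (let t = greatest_in le (Poly_Mapping.keys f)
      in Poly_Mapping.single t (Poly_Mapping.lookup f t)))"

definition mterms :: "('x, 'k::field) mvec \<Rightarrow> ('x pp \<times> nat) set" where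
  "mterms u = {(t, i). t \<in> Poly_Mapping.keys (Poly_Mapping.lookup u i)}"

text \<open>Signature of an element of R^m; it is again an element of R^m, namely a term or 0.\<close>

definition signature :: "('x pp \<times> nat) rel \<Rightarrow> ('x, 'k::field) mvec \<Rightarrow> ('x, 'k) mvec" where
  "signature lem u = (if u = 0 then 0 else
     (let (t, i) = greatest_in lem (mterms u)
      in Poly_Mapping.single i
           (Poly_Mapping.single t (Poly_Mapping.lookup (Poly_Mapping.lookup u i) t))))"

text \<open>Signature of an element of R^n, through the homomorphism \<open>\<phi>\<close> into R^m.\<close>

definition sig :: "('x pp \<times> nat) rel \<Rightarrow> (('x, 'k::field) mvec \<Rightarrow> ('x, 'k) mvec) \<Rightarrow>
    ('x, 'k) mvec \<Rightarrow> ('x, 'k) mvec" where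
  "sig lem \<phi> u = signature lem (\<phi> u)"

text \<open>The order on terms of R^m with their coefficients, extended by 0 as least element. It is
  only a preorder: terms that differ by a nonzero scalar are \<open>\<le>\<close> each other.\<close>

definition sig_le :: "('x pp \<times> nat) rel \<Rightarrow> ('x, 'k::field) mvec \<Rightarrow> ('x, 'k) mvec \<Rightarrow> bool" where
  "sig_le lem a b \<longleftrightarrow> a = 0 \<or>
     (\<exists>s i c t j d. c \<noteq> 0 \<and> d \<noteq> 0
        \<and> a = Poly_Mapping.single i (Poly_Mapping.single s c)
        \<and> b = Poly_Mapping.single j (Poly_Mapping.single t d)
        \<and> ((s, i), (t, j)) \<in> lem)"

definition sig_less :: "('x pp \<times> nat) rel \<Rightarrow> ('x, 'k::field) mvec \<Rightarrow> ('x, 'k) mvec \<Rightarrow> bool" where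
  "sig_less lem a b \<longleftrightarrow> sig_le lem a b \<and> \<not> sig_le lem b a"

definition sig_sim :: "('x, 'k::field) mvec \<Rightarrow> ('x, 'k) mvec \<Rightarrow> bool" where
  "sig_sim a b \<longleftrightarrow> (\<exists>s. s \<noteq> 0 \<and> a = vscale (Poly_Mapping.single 0 s) b)"


subsection \<open>Extensions\<close>

definition extension :: "nat \<Rightarrow> nat \<Rightarrow> (nat \<Rightarrow> ('x, 'k::field) mpoly) \<Rightarrow>
    (('x, 'k) mvec \<Rightarrow> ('x, 'k) mvec) \<Rightarrow> bool" where
  "extension m n g \<phi> \<longleftrightarrow> m \<le> n
     \<and> (\<forall>i\<in>{1..n}. g i \<noteq> 0)
     \<and> (\<forall>i\<in>{m+1..n}. g i \<in> module.span (*) (g ` {1..m}))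
     \<and> (\<forall>u\<in>free_mod n. \<phi> u \<in> free_mod m)
     \<and> (\<forall>u\<in>free_mod n. \<forall>v\<in>free_mod n. \<phi> (u + v) = \<phi> u + \<phi> v)
     \<and> (\<forall>a. \<forall>u\<in>free_mod n. \<phi> (vscale a u) = vscale a (\<phi> u))
     \<and> (\<forall>i\<in>{1..m}. \<phi> (Poly_Mapping.single i 1) = Poly_Mapping.single i 1)
     \<and> (\<forall>u\<in>free_mod n. bar n g u = bar m g (\<phi> u))"


subsection \<open>Reduction\<close>

text \<open>\<open>a e\<^sub>i\<close> reduces the term \<open>t\<close> (coefficient included) of the image of \<open>u\<close>.\<close>

definition reduces_term :: "'x pp rel \<Rightarrow> ('x pp \<times> nat) rel \<Rightarrow> nat \<Rightarrow> (nat \<Rightarrow> ('x, 'k::field) mpoly) \<Rightarrow>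
    (('x, 'k) mvec \<Rightarrow> ('x, 'k) mvec) \<Rightarrow> ('x, 'k) mvec \<Rightarrow> ('x, 'k) mpoly \<Rightarrow>
    ('x, 'k) mpoly \<Rightarrow> nat \<Rightarrow> bool" where
  "reduces_term le lem n g \<phi> u t a i \<longleftrightarrow>
     (\<exists>s\<in>Poly_Mapping.keys (bar n g u).
        t = Poly_Mapping.single s (Poly_Mapping.lookup (bar n g u) s))
     \<and> is_monomial a \<and> i \<in> {1..n}
     \<and> lead_term le (bar n g (Poly_Mapping.single i a)) = t
     \<and> sig_le lem (sig lem \<phi> (Poly_Mapping.single i a)) (sig lem \<phi> u)"

definition reg_reduces_term :: "'x pp rel \<Rightarrow> ('x pp \<times> nat) rel \<Rightarrow> nat \<Rightarrow> (nat \<Rightarrow> ('x, 'k::field) mpoly) \<Rightarrow>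
    (('x, 'k) mvec \<Rightarrow> ('x, 'k) mvec) \<Rightarrow> ('x, 'k) mvec \<Rightarrow> ('x, 'k) mpoly \<Rightarrow>
    ('x, 'k) mpoly \<Rightarrow> nat \<Rightarrow> bool" where
  "reg_reduces_term le lem n g \<phi> u t a i \<longleftrightarrow> reduces_term le lem n g \<phi> u t a i
     \<and> sig_less lem (sig lem \<phi> (Poly_Mapping.single i a)) (sig lem \<phi> u)"

definition sing_reduces_term :: "'x pp rel \<Rightarrow> ('x pp \<times> nat) rel \<Rightarrow> nat \<Rightarrow> (nat \<Rightarrow> ('x, 'k::field) mpoly) \<Rightarrow>
    (('x, 'k) mvec \<Rightarrow> ('x, 'k) mvec) \<Rightarrow> ('x, 'k) mvec \<Rightarrow> ('x, 'k) mpoly \<Rightarrow>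
    ('x, 'k) mpoly \<Rightarrow> nat \<Rightarrow> bool" where
  "sing_reduces_term le lem n g \<phi> u t a i \<longleftrightarrow> reduces_term le lem n g \<phi> u t a i
     \<and> sig_sim (sig lem \<phi> (Poly_Mapping.single i a)) (sig lem \<phi> u)"

definition red_step :: "'x pp rel \<Rightarrow> ('x pp \<times> nat) rel \<Rightarrow> nat \<Rightarrow> (nat \<Rightarrow> ('x, 'k::field) mpoly) \<Rightarrow>
    (('x, 'k) mvec \<Rightarrow> ('x, 'k) mvec) \<Rightarrow> ('x, 'k) mvec \<Rightarrow> ('x, 'k) mvec \<Rightarrow> bool" where
  "red_step le lem n g \<phi> u v \<longleftrightarrow>
     (\<exists>t a i. reduces_term le lem n g \<phi> u t a i \<and> v = u - Poly_Mapping.single i a)"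

definition reg_step :: "'x pp rel \<Rightarrow> ('x pp \<times> nat) rel \<Rightarrow> nat \<Rightarrow> (nat \<Rightarrow> ('x, 'k::field) mpoly) \<Rightarrow>
    (('x, 'k) mvec \<Rightarrow> ('x, 'k) mvec) \<Rightarrow> ('x, 'k) mvec \<Rightarrow> ('x, 'k) mvec \<Rightarrow> bool" where
  "reg_step le lem n g \<phi> u v \<longleftrightarrow>
     (\<exists>t a i. reg_reduces_term le lem n g \<phi> u t a i \<and> v = u - Poly_Mapping.single i a)"

definition regular_reduced :: "'x pp rel \<Rightarrow> ('x pp \<times> nat) rel \<Rightarrow> nat \<Rightarrow> (nat \<Rightarrow> ('x, 'k::field) mpoly) \<Rightarrow>
    (('x, 'k) mvec \<Rightarrow> ('x, 'k) mvec) \<Rightarrow> ('x, 'k) mvec \<Rightarrow> bool" where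
  "regular_reduced le lem n g \<phi> u \<longleftrightarrow> \<not> (\<exists>t a i. reg_reduces_term le lem n g \<phi> u t a i)"

text \<open>\<open>r\<close> is a result of regular reducing \<open>u\<close>. The steps are chosen freely, so this is a
  relation.\<close>

definition reg_reduces_to :: "'x pp rel \<Rightarrow> ('x pp \<times> nat) rel \<Rightarrow> nat \<Rightarrow> (nat \<Rightarrow> ('x, 'k::field) mpoly) \<Rightarrow>
    (('x, 'k) mvec \<Rightarrow> ('x, 'k) mvec) \<Rightarrow> ('x, 'k) mvec \<Rightarrow> ('x, 'k) mvec \<Rightarrow> bool" where
  "reg_reduces_to le lem n g \<phi> u r \<longleftrightarrow>
     (reg_step le lem n g \<phi>)\<^sup>*\<^sup>* u r \<and> regular_reduced le lem n g \<phi> r"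

definition regular_top_reducible :: "'x pp rel \<Rightarrow> ('x pp \<times> nat) rel \<Rightarrow> nat \<Rightarrow> (nat \<Rightarrow> ('x, 'k::field) mpoly) \<Rightarrow>
    (('x, 'k) mvec \<Rightarrow> ('x, 'k) mvec) \<Rightarrow> ('x, 'k) mvec \<Rightarrow> bool" where
  "regular_top_reducible le lem n g \<phi> u \<longleftrightarrow> bar n g u \<noteq> 0
     \<and> (\<exists>a i. reg_reduces_term le lem n g \<phi> u (lead_term le (bar n g u)) a i)"

abbreviation "regular_top_reduced le lem n g \<phi> u \<equiv> \<not> regular_top_reducible le lem n g \<phi> u"

definition singular_top_reducible :: "'x pp rel \<Rightarrow> ('x pp \<times> nat) rel \<Rightarrow> nat \<Rightarrow> (nat \<Rightarrow> ('x, 'k::field) mpoly) \<Rightarrow>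
    (('x, 'k) mvec \<Rightarrow> ('x, 'k) mvec) \<Rightarrow> ('x, 'k) mvec \<Rightarrow> bool" where
  "singular_top_reducible le lem n g \<phi> u \<longleftrightarrow> bar n g u \<noteq> 0
     \<and> (\<exists>a i. sing_reduces_term le lem n g \<phi> u (lead_term le (bar n g u)) a i)"

text \<open>Signature Groebner basis up to (but not including) the signature \<open>T\<close>: every element of
  lower signature reduces to zero, by regular or singular steps. An element \<open>v\<close> counts as
  zero when its image is zero; \<open>v\<close> itself may be a nonzero syzygy.\<close>

definition sig_GB_below :: "'x pp rel \<Rightarrow> ('x pp \<times> nat) rel \<Rightarrow> nat \<Rightarrow> (nat \<Rightarrow> ('x, 'k::field) mpoly) \<Rightarrow>
    (('x, 'k) mvec \<Rightarrow> ('x, 'k) mvec) \<Rightarrow> ('x, 'k) mvec \<Rightarrow> bool" where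
  "sig_GB_below le lem n g \<phi> T \<longleftrightarrow>
     (\<forall>u\<in>free_mod n. sig_less lem (sig lem \<phi> u) T \<longrightarrow>
        (\<exists>v. (red_step le lem n g \<phi>)\<^sup>*\<^sup>* u v \<and> bar n g v = 0))"


subsection \<open>S-pairs\<close>

text \<open>A gcd is only determined up to a unit, and so is the S-pair; every choice is admitted.\<close>

definition is_gcd_of :: "'a::comm_semiring_1 \<Rightarrow> 'a \<Rightarrow> 'a \<Rightarrow> bool" where
  "is_gcd_of d a b \<longleftrightarrow> d dvd a \<and> d dvd b \<and> (\<forall>c. c dvd a \<longrightarrow> c dvd b \<longrightarrow> c dvd d)"

definition regular_S_pair :: "'x pp rel \<Rightarrow> ('x pp \<times> nat) rel \<Rightarrow> nat \<Rightarrow> (nat \<Rightarrow> ('x, 'k::field) mpoly) \<Rightarrow>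
    (('x, 'k) mvec \<Rightarrow> ('x, 'k) mvec) \<Rightarrow> ('x, 'k) mvec \<Rightarrow> bool" where
  "regular_S_pair le lem n g \<phi> p \<longleftrightarrow>
     (\<exists>i\<in>{1..n}. \<exists>j\<in>{1..n}. \<exists>d a b.
        is_gcd_of d (lead_term le (g i)) (lead_term le (g j))
        \<and> lead_term le (g j) = a * d \<and> lead_term le (g i) = b * d
        \<and> p = Poly_Mapping.single i a - Poly_Mapping.single j b
        \<and> \<not> sig_sim (sig lem \<phi> (Poly_Mapping.single i a)) (sig lem \<phi> (Poly_Mapping.single j b)))"

end

theory Submission
  imports Defs "HOL-Library.Multiset"
begin

text \<open>A regular step preserves the signature together with its coefficient, so every result of
  regular reducing \<open>p\<close> or an element of \<open>M\<close> has the signature \<open>T\<close> of \<open>p\<close>. If two such results had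
  different images, their difference would have a signature below \<open>T\<close> and, by the Groebner basis
  hypothesis, its lead term would be reducible by a step of signature below \<open>T\<close>. The exponent of
  that lead term occurs in the image of one of the two results, which would not be regular reduced.
  Hence the images agree. The second claim compares lead terms: an element of \<open>M\<close> is regular top
  reduced iff its lead term survives the reduction, in which case the element itself is a singular
  reducer of \<open>p'\<close>; conversely a singular reducer of \<open>p'\<close> is, up to a scalar, an element of \<open>M\<close>.\<close>

subsection \<open>Term orders are well-founded\<close>

text \<open>Every sequence of numbers has a monotone subsequence. If it is decreasing, it is
  constant from the position of its least value on, and a constant tail is weakly
  increasing.\<close>

lemma nat_seq_mono_subseq:
  fixes s :: "nat \<Rightarrow> nat"
  shows "\<exists>r :: nat \<Rightarrow> nat. strict_mono r \<and> mono (s \<circ> r)"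
proof -
  obtain r where r: "strict_mono r" "monoseq (\<lambda>n. s (r n))"
    using seq_monosub[of s] by blast
  show ?thesis
  proof (cases "incseq (\<lambda>n. s (r n))")
    case True
    then show ?thesis using r(1) by (intro exI[of _ r]) (simp add: comp_def)
  next
    case False
    then have dec: "decseq (\<lambda>n. s (r n))" using r(2) by (simp add: monoseq_iff)
    obtain k where k: "\<And>j. s (r k) \<le> s (r j)"
      using ex_has_least_nat[of "\<lambda>_. True" 0 "\<lambda>n. s (r n)"] by blast
    have const: "s (r (k + j)) = s (r k)" for j
      using decseqD[OF dec, of k "k + j"] k[of "k + j"] by simp
    have "strict_mono (\<lambda>j. r (k + j))" using r(1) by (auto simp: strict_mono_def)
    moreover have "mono (s \<circ> (\<lambda>j. r (k + j)))" by (simp add: const comp_def mono_def)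
    ultimately show ?thesis by blast
  qed
qed

text \<open>Dickson's lemma in subsequence form. Coordinates are added one at a time: thinning out
  the sequence for a new coordinate keeps the earlier ones monotone.\<close>

lemma dickson_subseq:
  fixes f :: "nat \<Rightarrow> 'x \<Rightarrow> nat"
  assumes "finite X"
  shows "\<exists>r :: nat \<Rightarrow> nat. strict_mono r \<and> (\<forall>x\<in>X. mono (\<lambda>k. f (r k) x))"
  using assms
proof induction
  case empty
  show ?case by (intro exI[of _ "\<lambda>k. k"]) (simp add: strict_mono_def)
next
  case (insert y X)
  then obtain r :: "nat \<Rightarrow> nat" where r: "strict_mono r" "\<forall>x\<in>X. mono (\<lambda>k. f (r k) x)" by blast
  obtain q :: "nat \<Rightarrow> nat" where q: "strict_mono q" "mono ((\<lambda>k. f (r k) y) \<circ> q)"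
    using nat_seq_mono_subseq by blast
  have "strict_mono (r \<circ> q)" using r(1) q(1) by (simp add: strict_mono_def)
  moreover have "mono (\<lambda>k. f ((r \<circ> q) k) x)" if "x \<in> insert y X" for x
  proof (cases "x = y")
    case True
    then show ?thesis using q(2) by (simp add: comp_def)
  next
    case False
    then have "mono (\<lambda>k. f (r k) x)" using that r(2) by blast
    then show ?thesis using strict_mono_mono[OF q(1)] by (simp add: mono_def)
  qed
  ultimately show ?case by blast
qed

text \<open>In an infinite strict descent Dickson's lemma, over the finite type of variables, finds
  an earlier exponent dividing a later one. As \<open>0\<close> is least and the order is
  translation invariant, the earlier one is then at most the later one.\<close>

lemma term_order_wf:
  fixes le :: "('x::finite) pp rel"
  assumes "term_order le"
  shows "wf (le - Id)"
proof (rule ccontr)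
  assume "\<not> wf (le - Id)"
  then obtain f where f: "\<And>k. (f (Suc k), f k) \<in> le - Id"
    by (auto simp: wf_iff_no_infinite_down_chain)
  have tr: "trans le" and anti: "antisym le"
    and min0: "\<And>t. (0, t) \<in> le" and add: "\<And>s t v. (s, t) \<in> le \<Longrightarrow> (v + s, v + t) \<in> le"
    using assms by (auto simp: term_order_def order_on_defs)
  \<comment> \<open>The two members supplied by Dickson's lemma need not be neighbours, so the
    descent is extended to arbitrary distances; antisymmetry keeps it strict.\<close>
  have desc: "(f (j + Suc k), f j) \<in> le - Id" for j k
  proof (induction k)
    case 0
    show ?case using f by simp
  next
    case (Suc k)
    then show ?case using f[of "j + Suc k"] tr anti
      by (auto dest: transD antisymD)
  qed
  obtain r :: "nat \<Rightarrow> nat" where r: "strict_mono r"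
    "\<forall>x\<in>UNIV. mono (\<lambda>k. Poly_Mapping.lookup (f (r k)) x)"
    using dickson_subseq[of UNIV "\<lambda>k. Poly_Mapping.lookup (f k)"] by auto
  have "r 0 < r 1" using r(1) by (simp add: strict_mono_def)
  then obtain k where k: "r 1 = r 0 + Suc k" using less_imp_Suc_add by auto
  have "Poly_Mapping.lookup (f (r 0)) x \<le> Poly_Mapping.lookup (f (r 1)) x" for x
    using monoD[of "\<lambda>k. Poly_Mapping.lookup (f (r k)) x" 0 1] r(2) by simp
  \<comment> \<open>Subtraction of exponents is truncated; the coordinatewise inequality makes it
    exact.\<close>
  then have "f (r 1) = f (r 0) + (f (r 1) - f (r 0))"
    by (intro poly_mapping_eqI) (simp add: lookup_add lookup_minus)
  then have "(f (r 0), f (r 1)) \<in> le"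
    using add[OF min0, of "f (r 0)" "f (r 1) - f (r 0)"] by simp
  moreover have "(f (r 1), f (r 0)) \<in> le - Id" using desc[of "r 0" k] by (simp only: k)
  ultimately show False using antisymD[OF anti] by blast
qed

subsection \<open>Lead terms and signatures\<close>

lemma greatest_in_eqI:
  assumes "antisym r" "x \<in> A" "\<And>y. y \<in> A \<Longrightarrow> (y, x) \<in> r"
  shows "greatest_in r A = x"
  unfolding greatest_in_def using assms by (blast dest: antisymD)

lemma linear_order_on_finite_greatest:
  assumes "linear_order_on B r" "finite A" "A \<noteq> {}" "A \<subseteq> B"
  shows "\<exists>x\<in>A. \<forall>y\<in>A. (y, x) \<in> r"
  using assms(2,3,4)
proof (induction rule: finite_ne_induct)
  case (singleton x)
  then show ?case using assms(1) by (auto simp: order_on_defs refl_on_def)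
next
  case (insert z A)
  then obtain x where x: "x \<in> A" "\<forall>y\<in>A. (y, x) \<in> r" by auto
  have "x \<in> B" "z \<in> B" "x \<noteq> z" using x(1) insert.prems insert.hyps by auto
  then have "trans r" "(z, z) \<in> r" "(z, x) \<in> r \<or> (x, z) \<in> r"
    using assms(1) by (auto simp: order_on_defs refl_on_def total_on_def)
  then show ?case using x by (auto dest: transD)
qed

section \<open>Monomial multiples, terms of module elements, and the map \<open>bar\<close>\<close>

lemma lookup_single_times:
  fixes f :: "('x, 'k::field) mpoly"
  shows "Poly_Mapping.lookup (Poly_Mapping.single t c * f) (t + s) = c * Poly_Mapping.lookup f s"
  by (simp add: lookup_mult lookup_single when_mult)

lemma keys_single_times:
  fixes f :: "('x, 'k::field) mpoly"
  assumes "c \<noteq> 0"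
  shows "Poly_Mapping.keys (Poly_Mapping.single t c * f) = (+) t ` Poly_Mapping.keys f"
  using keys_mult[of "Poly_Mapping.single t c" f] assms
  by (auto simp: in_keys_iff lookup_single_times)

lemma lookup_vscale: "Poly_Mapping.lookup (vscale a u) i = a * Poly_Mapping.lookup u i"
  unfolding vscale_def by transfer (simp add: when_def)

lemma vscale_0 [simp]: "vscale a 0 = 0"
  by (rule poly_mapping_eqI) (simp add: lookup_vscale)

lemma vscale_single: "vscale a (Poly_Mapping.single i b) = Poly_Mapping.single i (a * b)"
  by (rule poly_mapping_eqI) (simp add: lookup_vscale lookup_single when_def)

text \<open>Signatures are compared through this relation on supports. Coefficients disappear, and
  the signature 0 corresponds to the empty set, which every set dominates.\<close>

definition dominated :: "'a rel \<Rightarrow> 'a set \<Rightarrow> 'a set \<Rightarrow> bool" where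
  "dominated r A B \<longleftrightarrow> (\<forall>x\<in>A. \<exists>y\<in>B. (x, y) \<in> r)"

lemma dominated_trans: "trans r \<Longrightarrow> dominated r A B \<Longrightarrow> dominated r B C \<Longrightarrow> dominated r A C"
  unfolding dominated_def by (meson transD)

lemma finite_mterms: "finite (mterms u)"
proof -
  have "mterms u \<subseteq> (\<Union>i\<in>Poly_Mapping.keys u.
      (\<lambda>t. (t, i)) ` Poly_Mapping.keys (Poly_Mapping.lookup u i))"
  proof (clarsimp simp: mterms_def)
    fix t i
    assume "t \<in> Poly_Mapping.keys (Poly_Mapping.lookup u i)"
    moreover from this have "i \<in> Poly_Mapping.keys u" by (auto simp: in_keys_iff)
    ultimately show "\<exists>j\<in>Poly_Mapping.keys u.
        (t, i) \<in> (\<lambda>t. (t, j)) ` Poly_Mapping.keys (Poly_Mapping.lookup u j)"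
      by blast
  qed
  then show ?thesis by (rule finite_subset) auto
qed

lemma mterms_empty_iff: "mterms u = {} \<longleftrightarrow> u = 0"
proof
  assume "mterms u = {}"
  then have "Poly_Mapping.keys (Poly_Mapping.lookup u i) = {}" for i
    unfolding mterms_def by blast
  then show "u = 0" by (intro poly_mapping_eqI) simp
qed (simp add: mterms_def)

lemma mterms_diff_subset: "mterms (u - v) \<subseteq> mterms u \<union> mterms v"
  by (auto simp: mterms_def in_keys_iff lookup_minus)

lemma mterms_vscale_single:
  fixes u :: "('x, 'k::field) mvec"
  assumes "c \<noteq> 0"
  shows "mterms (vscale (Poly_Mapping.single t c) u) = (\<lambda>(s, i). (t + s, i)) ` mterms u"
  using assms by (auto simp: mterms_def lookup_vscale keys_single_times)

lemma free_mod_iff: "u \<in> free_mod n \<longleftrightarrow> (\<forall>i. i \<notin> {1..n} \<longrightarrow> Poly_Mapping.lookup u i = 0)"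
  unfolding free_mod_def mem_Collect_eq subset_iff in_keys_iff by blast

lemma mterms_subset: "u \<in> free_mod m \<Longrightarrow> mterms u \<subseteq> UNIV \<times> {1..m}"
proof
  fix x
  assume u: "u \<in> free_mod m" and x: "x \<in> mterms u"
  then have "Poly_Mapping.lookup u (snd x) \<noteq> 0" by (auto simp: mterms_def)
  then have "snd x \<in> {1..m}" using u unfolding free_mod_iff by blast
  then show "x \<in> UNIV \<times> {1..m}" by (simp add: mem_Times_iff)
qed

lemma free_mod_diff: "u \<in> free_mod n \<Longrightarrow> v \<in> free_mod n \<Longrightarrow> u - v \<in> free_mod n"
  by (simp add: free_mod_iff lookup_minus)

lemma free_mod_single: "i \<in> {1..n} \<Longrightarrow> Poly_Mapping.single i a \<in> free_mod n"
  by (simp add: free_mod_def)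

lemma free_mod_vscale: "u \<in> free_mod n \<Longrightarrow> vscale a u \<in> free_mod n"
  by (simp add: free_mod_iff lookup_vscale)

lemma bar_diff: "bar n g (u - v) = bar n g u - bar n g v"
  by (simp add: bar_def lookup_minus left_diff_distrib sum_subtractf)

lemma bar_vscale: "bar n g (vscale a u) = a * bar n g u"
  by (simp add: bar_def lookup_vscale sum_distrib_left mult.assoc)

lemma bar_0 [simp]: "bar n g 0 = 0"
  by (simp add: bar_def)

lemma bar_single: "i \<in> {1..n} \<Longrightarrow> bar n g (Poly_Mapping.single i a) = a * g i"
  by (simp add: bar_def lookup_single when_def if_distrib[where f = "\<lambda>x. x * _"] cong: if_cong)

section \<open>Lead terms and signatures for fixed term orders\<close>

locale signature_orders =
  fixes le :: "('x::finite) pp rel"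
    and lem :: "('x pp \<times> nat) rel"
    and m :: nat
  assumes ord: "term_order le"
    and mord: "module_term_order m lem"
begin

lemma le_antisym: "antisym le" and le_trans: "trans le"
  and lem_antisym: "antisym lem" and lem_trans: "trans lem"
  using ord mord by (auto simp: term_order_def module_term_order_def order_on_defs)

lemma lem_refl: "x \<in> UNIV \<times> {1..m} \<Longrightarrow> (x, x) \<in> lem"
  using mord by (auto simp: module_term_order_def order_on_defs refl_on_def)

lemma lead_term_eqI:
  assumes "t \<in> Poly_Mapping.keys f" "\<And>s. s \<in> Poly_Mapping.keys f \<Longrightarrow> (s, t) \<in> le"
  shows "lead_term le f = Poly_Mapping.single t (Poly_Mapping.lookup f t)"
  using greatest_in_eqI[OF le_antisym assms] assms(1) by (auto simp: lead_term_def Let_def)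

lemma lead_termE:
  assumes "f \<noteq> 0"
  obtains t where "t \<in> Poly_Mapping.keys f" "\<And>s. s \<in> Poly_Mapping.keys f \<Longrightarrow> (s, t) \<in> le"
    "lead_term le f = Poly_Mapping.single t (Poly_Mapping.lookup f t)"
proof -
  have "linear_order_on UNIV le" using ord by (simp add: term_order_def)
  then have "\<exists>t\<in>Poly_Mapping.keys f. \<forall>s\<in>Poly_Mapping.keys f. (s, t) \<in> le"
    by (rule linear_order_on_finite_greatest) (simp_all add: assms)
  then obtain t where t: "t \<in> Poly_Mapping.keys f" "\<And>s. s \<in> Poly_Mapping.keys f \<Longrightarrow> (s, t) \<in> le"
    by blast
  show thesis by (rule that[OF t lead_term_eqI[OF t]])
qed

lemma lead_term_scale:
  fixes f :: "('x, 'k::field) mpoly"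
  assumes "c \<noteq> 0"
  shows "lead_term le (Poly_Mapping.single 0 c * f) = Poly_Mapping.single 0 c * lead_term le f"
proof (cases "f = 0")
  case False
  then obtain t where t: "t \<in> Poly_Mapping.keys f" "\<And>s. s \<in> Poly_Mapping.keys f \<Longrightarrow> (s, t) \<in> le"
    "lead_term le f = Poly_Mapping.single t (Poly_Mapping.lookup f t)"
    by (rule lead_termE) blast
  have keys: "Poly_Mapping.keys (Poly_Mapping.single 0 c * f) = Poly_Mapping.keys f"
    using assms by (simp add: keys_single_times)
  have "lead_term le (Poly_Mapping.single 0 c * f)
      = Poly_Mapping.single t (Poly_Mapping.lookup (Poly_Mapping.single 0 c * f) t)"
    by (rule lead_term_eqI) (simp_all add: keys t)
  then show ?thesis using lookup_single_times[of 0 c f t] by (simp add: t(3) mult_single)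
qed (simp add: lead_term_def)

lemma signature_eqI:
  assumes "(t, i) \<in> mterms u" "\<And>y. y \<in> mterms u \<Longrightarrow> (y, (t, i)) \<in> lem"
  shows "signature lem u
    = Poly_Mapping.single i (Poly_Mapping.single t (Poly_Mapping.lookup (Poly_Mapping.lookup u i) t))"
proof -
  have "u \<noteq> 0" using assms(1) mterms_empty_iff by blast
  then show ?thesis using greatest_in_eqI[OF lem_antisym assms] by (simp add: signature_def)
qed

lemma signatureE:
  assumes "u \<in> free_mod m" "u \<noteq> 0"
  obtains t i where "(t, i) \<in> mterms u" "\<And>y. y \<in> mterms u \<Longrightarrow> (y, (t, i)) \<in> lem"
    "signature lem u
      = Poly_Mapping.single i (Poly_Mapping.single t (Poly_Mapping.lookup (Poly_Mapping.lookup u i) t))"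
    "Poly_Mapping.lookup (Poly_Mapping.lookup u i) t \<noteq> 0"
proof -
  have "linear_order_on (UNIV \<times> {1..m}) lem" using mord by (simp add: module_term_order_def)
  from linear_order_on_finite_greatest[OF this finite_mterms _ mterms_subset[OF assms(1)]]
  obtain t i where ti: "(t, i) \<in> mterms u" "\<And>y. y \<in> mterms u \<Longrightarrow> (y, (t, i)) \<in> lem"
    using mterms_empty_iff assms(2) by (metis surj_pair)
  show thesis using that[OF ti signature_eqI[OF ti]] ti(1)
    by (simp add: mterms_def in_keys_iff)
qed

lemma signature_0 [simp]: "signature lem 0 = 0"
  by (simp add: signature_def)

lemma single_single_eq_iff:
  fixes c d :: "'k::field"
  assumes "c \<noteq> 0"
  shows "Poly_Mapping.single i (Poly_Mapping.single t c) = Poly_Mapping.single j (Poly_Mapping.single s d)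
    \<longleftrightarrow> i = j \<and> t = s \<and> c = d"
proof
  assume eq: "Poly_Mapping.single i (Poly_Mapping.single t c)
    = Poly_Mapping.single j (Poly_Mapping.single s d)"
  have "Poly_Mapping.lookup (Poly_Mapping.lookup (Poly_Mapping.single j (Poly_Mapping.single s d)) i) t
    = c" by (simp flip: eq)
  then show "i = j \<and> t = s \<and> c = d" using assms
    by (auto simp: lookup_single when_def split: if_splits)
qed simp

lemma signature_eq_0_iff:
  assumes "u \<in> free_mod m"
  shows "signature lem u = 0 \<longleftrightarrow> u = 0"
proof (cases "u = 0")
  case False
  then obtain t i where
    "signature lem u
      = Poly_Mapping.single i (Poly_Mapping.single t (Poly_Mapping.lookup (Poly_Mapping.lookup u i) t))"
    "Poly_Mapping.lookup (Poly_Mapping.lookup u i) t \<noteq> 0"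
    using signatureE[OF assms False] by metis
  \<comment> \<open>The vector \<open>0\<close> is itself a doubly nested \<open>single\<close>,
    with coefficient 0, so the nonzero coefficient tells it apart from the signature.\<close>
  then show ?thesis using False
    by (metis single_zero single_single_eq_iff)
qed simp

text \<open>For nonzero elements both sides compare the greatest terms of two finite nonempty sets.
  The cases with a zero element are separate because they have no greatest term.\<close>

lemma sig_le_signature_iff:
  assumes u: "u \<in> free_mod m" and v: "v \<in> free_mod m"
  shows "sig_le lem (signature lem u) (signature lem v) \<longleftrightarrow> dominated lem (mterms u) (mterms v)"
proof (cases "u = 0 \<or> v = 0")
  case True
  show ?thesis
  proof (cases "u = 0")
    case False
    then have "v = 0" using True by simp
    moreover have "\<not> sig_le lem (signature lem u) 0"
      using False u signature_eq_0_iff[OF u] unfolding sig_le_def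
      by (metis single_zero single_single_eq_iff)
    moreover have "\<not> dominated lem (mterms u) (mterms 0)"
      using False mterms_empty_iff[of u] mterms_empty_iff[of "0 :: (_, _) mvec"]
      by (auto simp: dominated_def)
    ultimately show ?thesis by simp
  qed (simp add: sig_le_def dominated_def mterms_empty_iff[THEN iffD2])
next
  case False
  then have u0: "u \<noteq> 0" and v0: "v \<noteq> 0" by auto
  obtain t i where ti: "(t, i) \<in> mterms u" "\<And>y. y \<in> mterms u \<Longrightarrow> (y, (t, i)) \<in> lem"
    "signature lem u
      = Poly_Mapping.single i (Poly_Mapping.single t (Poly_Mapping.lookup (Poly_Mapping.lookup u i) t))"
    "Poly_Mapping.lookup (Poly_Mapping.lookup u i) t \<noteq> 0"
    using signatureE[OF u u0] by metis
  obtain s j where sj: "(s, j) \<in> mterms v" "\<And>y. y \<in> mterms v \<Longrightarrow> (y, (s, j)) \<in> lem"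
    "signature lem v
      = Poly_Mapping.single j (Poly_Mapping.single s (Poly_Mapping.lookup (Poly_Mapping.lookup v j) s))"
    "Poly_Mapping.lookup (Poly_Mapping.lookup v j) s \<noteq> 0"
    using signatureE[OF v v0] by metis
  have "sig_le lem (signature lem u) (signature lem v) \<longleftrightarrow> ((t, i), (s, j)) \<in> lem"
  proof
    assume "sig_le lem (signature lem u) (signature lem v)"
    then show "((t, i), (s, j)) \<in> lem"
      using signature_eq_0_iff[OF u] u0 unfolding sig_le_def ti(3) sj(3)
      by (metis single_single_eq_iff ti(4) sj(4))
  next
    assume "((t, i), (s, j)) \<in> lem"
    then show "sig_le lem (signature lem u) (signature lem v)"
      unfolding sig_le_def ti(3) sj(3) using ti(4) sj(4) by blast
  qed
  also have "\<dots> \<longleftrightarrow> dominated lem (mterms u) (mterms v)"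
    using ti(1,2) sj(1,2) lem_trans unfolding dominated_def by (meson transD)
  finally show ?thesis .
qed

lemma sig_le_signature_trans:
  assumes "u \<in> free_mod m" "v \<in> free_mod m" "w \<in> free_mod m"
    and "sig_le lem (signature lem u) (signature lem v)" "sig_le lem (signature lem v) (signature lem w)"
  shows "sig_le lem (signature lem u) (signature lem w)"
  using assms dominated_trans[OF lem_trans] by (simp add: sig_le_signature_iff)

lemma sig_le_signature_refl:
  "u \<in> free_mod m \<Longrightarrow> sig_le lem (signature lem u) (signature lem u)"
  using mterms_subset[of u m] lem_refl by (fastforce simp: sig_le_signature_iff dominated_def)

text \<open>A difference has no terms outside the two supports, and \<open>mterms u\<close>
  dominates both of them.\<close>

lemma sig_le_signature_diff:
  assumes "u \<in> free_mod m" "v \<in> free_mod m" "sig_le lem (signature lem v) (signature lem u)"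
  shows "sig_le lem (signature lem (u - v)) (signature lem u)"
proof -
  have "dominated lem (mterms u) (mterms u)"
    using sig_le_signature_refl[OF assms(1)] sig_le_signature_iff[OF assms(1,1)] by blast
  then show ?thesis using assms mterms_diff_subset[of u v]
    by (auto simp: sig_le_signature_iff free_mod_diff dominated_def)
qed

text \<open>The greatest term of \<open>u\<close> lies strictly above all terms of \<open>v\<close>,
  so subtraction leaves its coefficient alone. This is why regular steps preserve the signature
  exactly.\<close>

lemma signature_diff_eq:
  assumes u: "u \<in> free_mod m" and v: "v \<in> free_mod m"
    and less: "sig_less lem (signature lem v) (signature lem u)"
  shows "signature lem (u - v) = signature lem u"
proof -
  have dom: "dominated lem (mterms v) (mterms u)" "\<not> dominated lem (mterms u) (mterms v)"
    using less u v by (auto simp: sig_less_def sig_le_signature_iff)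
  then have "u \<noteq> 0" using mterms_empty_iff[of u] by (auto simp: dominated_def)
  then obtain t i where ti: "(t, i) \<in> mterms u" "\<And>y. y \<in> mterms u \<Longrightarrow> (y, (t, i)) \<in> lem"
    "signature lem u
      = Poly_Mapping.single i (Poly_Mapping.single t (Poly_Mapping.lookup (Poly_Mapping.lookup u i) t))"
    using signatureE[OF u] by metis
  have below: "(y, (t, i)) \<in> lem" if "y \<in> mterms v" for y
    using that dom(1) ti(2) lem_trans unfolding dominated_def by (meson transD)
  \<comment> \<open>Otherwise this single term of \<open>v\<close> would dominate all of
    \<open>mterms u\<close>.\<close>
  have "(t, i) \<notin> mterms v" using dom(2) ti(2) by (auto simp: dominated_def)
  then have 0: "Poly_Mapping.lookup (Poly_Mapping.lookup v i) t = 0"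
    by (simp add: mterms_def in_keys_iff)
  then have "(t, i) \<in> mterms (u - v)"
    using ti(1) by (simp add: mterms_def in_keys_iff lookup_minus)
  then have "signature lem (u - v) = Poly_Mapping.single i
      (Poly_Mapping.single t (Poly_Mapping.lookup (Poly_Mapping.lookup (u - v) i) t))"
    using ti(2) below mterms_diff_subset[of u v] by (intro signature_eqI) auto
  then show ?thesis by (simp add: ti(3) lookup_minus 0)
qed

text \<open>Equal signatures agree in their coefficients too, so the greatest terms cancel in the
  difference.\<close>

lemma sig_less_signature_diff:
  assumes u: "u \<in> free_mod m" and v: "v \<in> free_mod m"
    and eq: "signature lem u = signature lem v" and ne: "u \<noteq> v"
  shows "sig_less lem (signature lem (u - v)) (signature lem v)"
proof -
  have u0: "u \<noteq> 0" and v0: "v \<noteq> 0"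
    using eq ne signature_eq_0_iff[OF u] signature_eq_0_iff[OF v] by auto
  obtain t i where ti: "(t, i) \<in> mterms u" "\<And>y. y \<in> mterms u \<Longrightarrow> (y, (t, i)) \<in> lem"
    "signature lem u
      = Poly_Mapping.single i (Poly_Mapping.single t (Poly_Mapping.lookup (Poly_Mapping.lookup u i) t))"
    "Poly_Mapping.lookup (Poly_Mapping.lookup u i) t \<noteq> 0"
    using signatureE[OF u u0] by metis
  obtain s j where sj: "(s, j) \<in> mterms v" "\<And>y. y \<in> mterms v \<Longrightarrow> (y, (s, j)) \<in> lem"
    "signature lem v
      = Poly_Mapping.single j (Poly_Mapping.single s (Poly_Mapping.lookup (Poly_Mapping.lookup v j) s))"
    using signatureE[OF v v0] by metis
  have "i = j \<and> t = s \<and>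
    Poly_Mapping.lookup (Poly_Mapping.lookup u i) t = Poly_Mapping.lookup (Poly_Mapping.lookup v j) s"
    using eq unfolding ti(3) sj(3) single_single_eq_iff[OF ti(4)] .
  then have same: "i = j" "t = s"
    "Poly_Mapping.lookup (Poly_Mapping.lookup u i) t = Poly_Mapping.lookup (Poly_Mapping.lookup v i) t"
    by auto
  have notin: "(t, i) \<notin> mterms (u - v)"
    by (simp add: mterms_def in_keys_iff lookup_minus same(3))
  have below: "(y, (t, i)) \<in> lem" if "y \<in> mterms (u - v)" for y
    using that mterms_diff_subset[of u v] ti(2) sj(2) same by blast
  have "dominated lem (mterms (u - v)) (mterms v)"
    using below sj(1) same by (auto simp: dominated_def)
  \<comment> \<open>A term of \<open>u - v\<close> above \<open>(t, i)\<close> would, by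
    \<open>below\<close> and antisymmetry, be \<open>(t, i)\<close> itself, which has
    cancelled.\<close>
  moreover have "\<not> dominated lem (mterms v) (mterms (u - v))"
    using below notin sj(1) same lem_antisym unfolding dominated_def by (metis antisymD)
  ultimately show ?thesis using u v by (simp add: sig_less_def sig_le_signature_iff free_mod_diff)
qed

text \<open>Multiplication by a monomial translates all exponents, and the module order respects
  translation, so the greatest term moves to the greatest term.\<close>

lemma signature_vscale_single:
  assumes u: "u \<in> free_mod m" and c: "c \<noteq> 0"
  shows "signature lem (vscale (Poly_Mapping.single t c) u)
    = vscale (Poly_Mapping.single t c) (signature lem u)"
proof (cases "u = 0")
  case True
  then show ?thesis by simp
next
  case False
  then obtain s i where si: "(s, i) \<in> mterms u" "\<And>y. y \<in> mterms u \<Longrightarrow> (y, (s, i)) \<in> lem"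
    "signature lem u
      = Poly_Mapping.single i (Poly_Mapping.single s (Poly_Mapping.lookup (Poly_Mapping.lookup u i) s))"
    using signatureE[OF u] by metis
  have "((t + s', i'), (t + s, i)) \<in> lem" if "(s', i') \<in> mterms u" for s' i'
    using si(2)[OF that] mord by (simp add: module_term_order_def)
  then have "signature lem (vscale (Poly_Mapping.single t c) u) = Poly_Mapping.single i
    (Poly_Mapping.single (t + s)
      (Poly_Mapping.lookup (Poly_Mapping.lookup (vscale (Poly_Mapping.single t c) u) i) (t + s)))"
    using si(1) by (intro signature_eqI) (force simp: mterms_vscale_single[OF c])+
  then show ?thesis
    by (simp add: si(3) lookup_vscale lookup_single_times vscale_single mult_single)
qed

end

subsection \<open>Reduction in an extension\<close>

locale signature_extension = signature_orders le lem m
  for le :: "('x::finite) pp rel" and lem :: "('x pp \<times> nat) rel" and m :: nat +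
  fixes n :: nat
    and g :: "nat \<Rightarrow> ('x, 'k::field) mpoly"
    and \<phi> :: "('x, 'k) mvec \<Rightarrow> ('x, 'k) mvec"
  assumes ext: "extension m n g \<phi>"
begin

lemma phi_free_mod: "u \<in> free_mod n \<Longrightarrow> \<phi> u \<in> free_mod m"
  using ext by (simp add: extension_def)

text \<open>\<open>extension\<close> states additivity for sums only; it is applied to
  \<open>(u - v) + v\<close>.\<close>

lemma phi_diff:
  assumes "u \<in> free_mod n" "v \<in> free_mod n"
  shows "\<phi> (u - v) = \<phi> u - \<phi> v"
proof -
  have "\<phi> ((u - v) + v) = \<phi> (u - v) + \<phi> v"
    using ext assms free_mod_diff[OF assms] unfolding extension_def by blast
  then show ?thesis by simp
qed

lemma phi_vscale: "u \<in> free_mod n \<Longrightarrow> \<phi> (vscale a u) = vscale a (\<phi> u)"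
  using ext by (simp add: extension_def)

lemma bar_phi: "u \<in> free_mod n \<Longrightarrow> bar n g u = bar m g (\<phi> u)"
  using ext by (simp add: extension_def)

lemma sig_vscale_single:
  "u \<in> free_mod n \<Longrightarrow> c \<noteq> 0 \<Longrightarrow>
    sig lem \<phi> (vscale (Poly_Mapping.single t c) u) = vscale (Poly_Mapping.single t c) (sig lem \<phi> u)"
  by (simp add: sig_def phi_vscale phi_free_mod signature_vscale_single)

lemma bar_monomial_ne_0:
  assumes "is_monomial a" "i \<in> {1..n}"
  shows "bar n g (Poly_Mapping.single i a) \<noteq> 0"
proof -
  obtain t c where a: "a = Poly_Mapping.single t c" "c \<noteq> 0"
    using assms(1) by (auto simp: is_monomial_def)
  have "g i \<noteq> 0" using ext assms(2) by (simp add: extension_def)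
  then have "Poly_Mapping.keys (a * g i) \<noteq> {}"
    by (simp add: a keys_single_times)
  then show ?thesis using assms(2) by (simp add: bar_single)
qed

text \<open>Signature 0 forces \<open>\<phi> u = 0\<close>, and the image in the polynomial ring
  depends on \<open>\<phi> u\<close> alone.\<close>

lemma sig_eq_0_bar: "u \<in> free_mod n \<Longrightarrow> sig lem \<phi> u = 0 \<Longrightarrow> bar n g u = 0"
  by (simp add: sig_def signature_eq_0_iff phi_free_mod bar_phi)

lemma sig_monomial_ne_0:
  "is_monomial a \<Longrightarrow> i \<in> {1..n} \<Longrightarrow> sig lem \<phi> (Poly_Mapping.single i a) \<noteq> 0"
  using bar_monomial_ne_0 sig_eq_0_bar free_mod_single by blast

text \<open>A nonzero constant translates exponents by \<open>0\<close>, so the set of terms stays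
  the same.\<close>

lemma sig_le_scaled:
  assumes "u \<in> free_mod n" "v \<in> free_mod n" "c \<noteq> 0"
  shows "sig_le lem (sig lem \<phi> (vscale (Poly_Mapping.single 0 c) u)) (sig lem \<phi> v)
      \<longleftrightarrow> sig_le lem (sig lem \<phi> u) (sig lem \<phi> v)"
    and "sig_le lem (sig lem \<phi> v) (sig lem \<phi> (vscale (Poly_Mapping.single 0 c) u))
      \<longleftrightarrow> sig_le lem (sig lem \<phi> v) (sig lem \<phi> u)"
  using assms
  by (simp_all add: sig_def phi_vscale phi_free_mod free_mod_vscale sig_le_signature_iff
      mterms_vscale_single)

lemma sig_less_scaled:
  assumes "u \<in> free_mod n" "v \<in> free_mod n" "c \<noteq> 0"
  shows "sig_less lem (sig lem \<phi> (vscale (Poly_Mapping.single 0 c) u)) (sig lem \<phi> v)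
      \<longleftrightarrow> sig_less lem (sig lem \<phi> u) (sig lem \<phi> v)"
  using sig_le_scaled[OF assms] by (simp add: sig_less_def)

lemma sig_le_trans:
  "u \<in> free_mod n \<Longrightarrow> v \<in> free_mod n \<Longrightarrow> w \<in> free_mod n \<Longrightarrow>
    sig_le lem (sig lem \<phi> u) (sig lem \<phi> v) \<Longrightarrow> sig_le lem (sig lem \<phi> v) (sig lem \<phi> w) \<Longrightarrow>
    sig_le lem (sig lem \<phi> u) (sig lem \<phi> w)"
  unfolding sig_def by (blast intro: sig_le_signature_trans phi_free_mod)

lemma is_monomial_scale:
  "is_monomial (a :: ('x, 'k) mpoly) \<Longrightarrow> c \<noteq> 0 \<Longrightarrow> is_monomial (Poly_Mapping.single 0 c * a)"
  unfolding is_monomial_def by (metis mult_single no_zero_divisors)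

section \<open>Effect of a single reduction step\<close>

text \<open>Turns the equation of lead terms into facts about supports: the reducer has greatest
  exponent \<open>s\<close> with the coefficient that \<open>u\<close> has there, so the step
  cancels that term.\<close>

lemma reduces_termE:
  assumes "reduces_term le lem n g \<phi> u t a i"
  obtains s where "s \<in> Poly_Mapping.keys (bar n g u)"
    "t = Poly_Mapping.single s (Poly_Mapping.lookup (bar n g u) s)"
    "s \<in> Poly_Mapping.keys (bar n g (Poly_Mapping.single i a))"
    "Poly_Mapping.lookup (bar n g (Poly_Mapping.single i a)) s = Poly_Mapping.lookup (bar n g u) s"
    "\<And>s'. s' \<in> Poly_Mapping.keys (bar n g (Poly_Mapping.single i a)) \<Longrightarrow> (s', s) \<in> le"
proof -
  obtain s where s: "s \<in> Poly_Mapping.keys (bar n g u)"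
    "t = Poly_Mapping.single s (Poly_Mapping.lookup (bar n g u) s)"
    and mon: "is_monomial a" "i \<in> {1..n}"
    and lt: "lead_term le (bar n g (Poly_Mapping.single i a)) = t"
    using assms by (auto simp: reduces_term_def)
  obtain s0 where s0: "s0 \<in> Poly_Mapping.keys (bar n g (Poly_Mapping.single i a))"
    "\<And>s'. s' \<in> Poly_Mapping.keys (bar n g (Poly_Mapping.single i a)) \<Longrightarrow> (s', s0) \<in> le"
    "lead_term le (bar n g (Poly_Mapping.single i a))
      = Poly_Mapping.single s0 (Poly_Mapping.lookup (bar n g (Poly_Mapping.single i a)) s0)"
    using lead_termE[OF bar_monomial_ne_0[OF mon]] by blast
  \<comment> \<open>Both descriptions of \<open>t\<close> are read at \<open>s\<close>. The value is
    nonzero, which identifies \<open>s0\<close> with \<open>s\<close>.\<close>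
  have "Poly_Mapping.lookup t s = Poly_Mapping.lookup (bar n g u) s"
    by (simp add: s(2))
  then have "s0 = s \<and> Poly_Mapping.lookup (bar n g (Poly_Mapping.single i a)) s
      = Poly_Mapping.lookup (bar n g u) s"
    using s(1) lt s0(3) by (auto simp: lookup_single when_def in_keys_iff split: if_splits)
  then show thesis using that s s0 by metis
qed

lemma reduces_term_free_mod:
  "reduces_term le lem n g \<phi> u t a i \<Longrightarrow> Poly_Mapping.single i a \<in> free_mod n"
  by (simp add: reduces_term_def free_mod_single)

text \<open>All terms of the reducer lie at or below the reduced term, hence strictly below the lead
  term, which therefore survives.\<close>

lemma lead_term_red_step:
  assumes red: "reduces_term le lem n g \<phi> u t a i" and t: "t \<noteq> lead_term le (bar n g u)"
  shows "bar n g (u - Poly_Mapping.single i a) \<noteq> 0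
    \<and> lead_term le (bar n g (u - Poly_Mapping.single i a)) = lead_term le (bar n g u)"
proof -
  let ?v = "bar n g (Poly_Mapping.single i a)"
  obtain s where s: "s \<in> Poly_Mapping.keys (bar n g u)"
    "t = Poly_Mapping.single s (Poly_Mapping.lookup (bar n g u) s)"
    "\<And>s'. s' \<in> Poly_Mapping.keys ?v \<Longrightarrow> (s', s) \<in> le"
    using reduces_termE[OF red] by metis
  have "bar n g u \<noteq> 0" using s(1) by auto
  then obtain t0 where t0: "t0 \<in> Poly_Mapping.keys (bar n g u)"
    "\<And>s. s \<in> Poly_Mapping.keys (bar n g u) \<Longrightarrow> (s, t0) \<in> le"
    "lead_term le (bar n g u) = Poly_Mapping.single t0 (Poly_Mapping.lookup (bar n g u) t0)"
    by (rule lead_termE) blast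
  have "s \<noteq> t0" using t s(2) t0(3) by auto
  then have "t0 \<notin> Poly_Mapping.keys ?v"
    using s(1,3) t0(2) le_antisym by (meson antisymD)
  then have 0: "Poly_Mapping.lookup ?v t0 = 0" by (simp add: in_keys_iff)
  have in_diff: "t0 \<in> Poly_Mapping.keys (bar n g u - ?v)"
    using t0(1) 0 by (simp add: in_keys_iff lookup_minus)
  have "(s', t0) \<in> le" if "s' \<in> Poly_Mapping.keys (bar n g u - ?v)" for s'
    using that keys_diff[of "bar n g u" ?v] t0(2) s(1,3) le_trans by (meson UnE subsetD transD)
  then have "lead_term le (bar n g u - ?v)
      = Poly_Mapping.single t0 (Poly_Mapping.lookup (bar n g u - ?v) t0)"
    using in_diff by (intro lead_term_eqI) auto
  then show ?thesis using in_diff by (auto simp: bar_diff t0(3) lookup_minus 0)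
qed

lemma red_step_free_mod: "red_step le lem n g \<phi> u v \<Longrightarrow> u \<in> free_mod n \<Longrightarrow> v \<in> free_mod n"
  by (auto simp: red_step_def intro: free_mod_diff dest: reduces_term_free_mod)

lemma sig_red_step:
  "reduces_term le lem n g \<phi> u t a i \<Longrightarrow> u \<in> free_mod n \<Longrightarrow>
    sig_le lem (sig lem \<phi> (u - Poly_Mapping.single i a)) (sig lem \<phi> u)"
  unfolding sig_def using reduces_term_free_mod
  by (auto simp: phi_diff phi_free_mod reduces_term_def sig_def free_mod_single
      intro!: sig_le_signature_diff)

text \<open>Steps at other terms leave the lead term in place, so some step on the way to image 0
  must hit it. Signatures never rise along the way, so that reducer is already admissible for
  \<open>u\<close>.\<close>

lemma reduces_to_0_top_reducible:
  assumes "(red_step le lem n g \<phi>)\<^sup>*\<^sup>* u v" "bar n g v = 0" "u \<in> free_mod n" "bar n g u \<noteq> 0"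
  shows "\<exists>a i. reduces_term le lem n g \<phi> u (lead_term le (bar n g u)) a i"
  using assms
proof (induction rule: converse_rtranclp_induct)
  case base
  then show ?case by simp
next
  case (step u w)
  then obtain t a i where red: "reduces_term le lem n g \<phi> u t a i"
    and w: "w = u - Poly_Mapping.single i a"
    by (auto simp: red_step_def)
  show ?case
  proof (cases "t = lead_term le (bar n g u)")
    case True
    then show ?thesis using red by blast
  next
    case False
    have wf: "w \<in> free_mod n" using red_step_free_mod step.hyps(1) step.prems(2) by blast
    have lt: "bar n g w \<noteq> 0" "lead_term le (bar n g w) = lead_term le (bar n g u)"
      using lead_term_red_step[OF red False] by (auto simp: w)
    then obtain b j where bj: "reduces_term le lem n g \<phi> w (lead_term le (bar n g u)) b j"
      using step.IH[OF step.prems(1) wf] by auto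
    \<comment> \<open>The reducer found for \<open>w\<close> is carried back to
      \<open>u\<close>.\<close>
    have "sig_le lem (sig lem \<phi> (Poly_Mapping.single j b)) (sig lem \<phi> u)"
      using bj sig_red_step[OF red step.prems(2)] sig_le_trans step.prems(2) wf
        reduces_term_free_mod[OF bj] by (metis w reduces_term_def)
    moreover have "\<exists>s\<in>Poly_Mapping.keys (bar n g u).
        lead_term le (bar n g u) = Poly_Mapping.single s (Poly_Mapping.lookup (bar n g u) s)"
      using lead_termE[OF step.prems(3)] by metis
    ultimately have "reduces_term le lem n g \<phi> u (lead_term le (bar n g u)) b j"
      using bj by (simp add: reduces_term_def)
    then show ?thesis by blast
  qed
qed

lemma reg_step_free_mod: "reg_step le lem n g \<phi> u v \<Longrightarrow> u \<in> free_mod n \<Longrightarrow> v \<in> free_mod n"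
  by (auto simp: reg_step_def reg_reduces_term_def intro: free_mod_diff dest: reduces_term_free_mod)

lemma sig_reg_step:
  assumes "reg_step le lem n g \<phi> u v" "u \<in> free_mod n"
  shows "sig lem \<phi> v = sig lem \<phi> u"
proof -
  obtain t a i where red: "reduces_term le lem n g \<phi> u t a i"
    and less: "sig_less lem (sig lem \<phi> (Poly_Mapping.single i a)) (sig lem \<phi> u)"
    and v: "v = u - Poly_Mapping.single i a"
    using assms(1) by (auto simp: reg_step_def reg_reduces_term_def)
  show ?thesis
    using less assms(2) reduces_term_free_mod[OF red]
    by (auto simp: sig_def v phi_diff phi_free_mod intro!: signature_diff_eq)
qed

lemma reg_steps_free_mod_sig:
  assumes "(reg_step le lem n g \<phi>)\<^sup>*\<^sup>* u v" "u \<in> free_mod n"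
  shows "v \<in> free_mod n \<and> sig lem \<phi> v = sig lem \<phi> u"
  using assms by (induction rule: rtranclp_induct) (auto simp: sig_reg_step reg_step_free_mod)

section \<open>Termination of regular reduction\<close>

text \<open>A step removes one exponent from the support and adds only smaller ones, so the support
  decreases in the multiset order.\<close>

lemma reg_step_mult:
  assumes "reg_step le lem n g \<phi> u v"
  shows "(mset_set (Poly_Mapping.keys (bar n g v)), mset_set (Poly_Mapping.keys (bar n g u)))
    \<in> mult (le - Id)"
proof -
  obtain t a i where red: "reduces_term le lem n g \<phi> u t a i"
    and v: "v = u - Poly_Mapping.single i a"
    using assms by (auto simp: reg_step_def reg_reduces_term_def)
  let ?w = "bar n g (Poly_Mapping.single i a)"
  obtain s where s: "s \<in> Poly_Mapping.keys (bar n g u)"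
    "Poly_Mapping.lookup ?w s = Poly_Mapping.lookup (bar n g u) s"
    "\<And>s'. s' \<in> Poly_Mapping.keys ?w \<Longrightarrow> (s', s) \<in> le"
    using reduces_termE[OF red] by metis
  define U V where "U = Poly_Mapping.keys (bar n g u)" and "V = Poly_Mapping.keys (bar n g v)"
  have fin: "finite U" "finite V" by (simp_all add: U_def V_def)
  have sV: "s \<notin> V" by (simp add: V_def v bar_diff in_keys_iff lookup_minus s(2))
  have "V - U \<subseteq> Poly_Mapping.keys ?w"
    using keys_diff[of "bar n g u" ?w] by (auto simp: U_def V_def v bar_diff)
  \<comment> \<open>New exponents come from the reducer, so they are at most \<open>s\<close>; they
    differ from \<open>s\<close> because \<open>s\<close> was cancelled.\<close>
  then have below: "(x, s) \<in> le - Id" if "x \<in> V - U" for x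
    using that s(3) sV by auto
  have sUV: "s \<in> U - V" using s(1) sV by (simp add: U_def)
  \<comment> \<open>The common part \<open>U \<inter> V\<close> is kept, and \<open>U - V\<close>,
    which contains \<open>s\<close>, is replaced by the smaller exponents in
    \<open>V - U\<close>.\<close>
  have "(mset_set (U \<inter> V) + mset_set (V - U), mset_set (U \<inter> V) + mset_set (U - V)) \<in> mult (le - Id)"
    using sUV fin below by (intro one_step_implies_mult) (auto simp: mset_set_empty_iff)
  moreover have "mset_set (U \<inter> V) + mset_set (V - U) = mset_set V"
    using fin by (subst mset_set_Union[symmetric]) (auto intro: arg_cong[where f = mset_set])
  moreover have "mset_set (U \<inter> V) + mset_set (U - V) = mset_set U"
    using fin by (subst mset_set_Union[symmetric]) (auto intro: arg_cong[where f = mset_set])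
  ultimately show ?thesis by (simp add: U_def V_def)
qed

text \<open>Well-founded induction on the multiset of exponents of the image, as the multiset
  extension of a well-founded order is well-founded.\<close>

lemma reg_reduces_to_exists: "\<exists>r. reg_reduces_to le lem n g \<phi> u r"
proof -
  have "wf (inv_image (mult (le - Id)) (\<lambda>u. mset_set (Poly_Mapping.keys (bar n g u))))"
    by (intro wf_inv_image wf_mult term_order_wf ord)
  then show ?thesis
  proof (induction u rule: wf_induct_rule)
    case (less u)
    show ?case
    proof (cases "regular_reduced le lem n g \<phi> u")
      case True
      then show ?thesis by (auto simp: reg_reduces_to_def)
    next
      case False
      then obtain v where v: "reg_step le lem n g \<phi> u v"
        by (auto simp: regular_reduced_def reg_step_def)
      then obtain r where "reg_reduces_to le lem n g \<phi> v r"
        using less[of v] reg_step_mult[OF v] by auto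
      then show ?thesis using v
        by (auto simp: reg_reduces_to_def intro: converse_rtranclp_into_rtranclp)
    qed
  qed
qed

section \<open>Uniqueness of the regular reduced image\<close>

text \<open>A reducer must match the coefficient as well as the exponent. A mismatch is repaired by
  a nonzero constant, which does not affect the comparison of signatures.\<close>

lemma reg_reducer_rescaled:
  assumes s: "s \<in> Poly_Mapping.keys (bar n g u)" and u: "u \<in> free_mod n"
    and a: "is_monomial a" "i \<in> {1..n}"
    and lt: "lead_term le (bar n g (Poly_Mapping.single i a)) = Poly_Mapping.single s c"
    and less: "sig_less lem (sig lem \<phi> (Poly_Mapping.single i a)) (sig lem \<phi> u)"
  shows "\<exists>b. reg_reduces_term le lem n g \<phi> u
    (Poly_Mapping.single s (Poly_Mapping.lookup (bar n g u) s)) b i"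
proof -
  obtain t where t: "t \<in> Poly_Mapping.keys (bar n g (Poly_Mapping.single i a))"
      "lead_term le (bar n g (Poly_Mapping.single i a))
        = Poly_Mapping.single t (Poly_Mapping.lookup (bar n g (Poly_Mapping.single i a)) t)"
    using lead_termE[OF bar_monomial_ne_0[OF a]] by metis
  then have c: "c \<noteq> 0" using lt by (auto simp: in_keys_iff dest!: arg_cong[where f = Poly_Mapping.keys])
  \<comment> \<open>The factor turning the coefficient \<open>c\<close> of the candidate into the
    coefficient of \<open>s\<close> in the image of \<open>u\<close>.\<close>
  define d where "d = Poly_Mapping.lookup (bar n g u) s / c"
  have d: "d \<noteq> 0" "d * c = Poly_Mapping.lookup (bar n g u) s"
    using c s by (simp_all add: d_def in_keys_iff)
  have scale: "Poly_Mapping.single i (Poly_Mapping.single 0 d * a)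
      = vscale (Poly_Mapping.single 0 d) (Poly_Mapping.single i a)"
    by (simp add: vscale_single)
  have "lead_term le (bar n g (Poly_Mapping.single i (Poly_Mapping.single 0 d * a)))
      = Poly_Mapping.single s (Poly_Mapping.lookup (bar n g u) s)"
    using d by (simp add: scale bar_vscale lead_term_scale lt mult_single)
  moreover have "sig_less lem (sig lem \<phi> (Poly_Mapping.single i (Poly_Mapping.single 0 d * a)))
      (sig lem \<phi> u)"
    using less u a(2) d(1) by (simp add: scale sig_less_scaled free_mod_single)
  ultimately have "reg_reduces_term le lem n g \<phi> u
      (Poly_Mapping.single s (Poly_Mapping.lookup (bar n g u) s)) (Poly_Mapping.single 0 d * a) i"
    using s a d(1) is_monomial_scale
    by (auto simp: reg_reduces_term_def reduces_term_def sig_less_def)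
  then show ?thesis by blast
qed

text \<open>The one place where the Groebner basis hypothesis enters: it is applied to
  \<open>u - v\<close>, and it makes the outcome of regular reduction depend only on the
  signature.\<close>

lemma regular_reduced_bar_eq:
  assumes u: "u \<in> free_mod n" "regular_reduced le lem n g \<phi> u" "sig lem \<phi> u = T"
    and v: "v \<in> free_mod n" "regular_reduced le lem n g \<phi> v" "sig lem \<phi> v = T"
    and gb: "sig_GB_below le lem n g \<phi> T"
  shows "bar n g u = bar n g v"
proof (rule ccontr)
  assume ne: "bar n g u \<noteq> bar n g v"
  then have "\<phi> u \<noteq> \<phi> v" using u(1) v(1) by (auto simp: bar_phi)
  then have less: "sig_less lem (sig lem \<phi> (u - v)) T"
    using sig_less_signature_diff[of "\<phi> u" "\<phi> v"] u v
    by (simp add: sig_def phi_diff phi_free_mod)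
  have uv: "u - v \<in> free_mod n" using u(1) v(1) by (rule free_mod_diff)
  have ne0: "bar n g (u - v) \<noteq> 0" using ne by (simp add: bar_diff)
  then obtain a i where ai: "reduces_term le lem n g \<phi> (u - v) (lead_term le (bar n g (u - v))) a i"
    using gb uv less reduces_to_0_top_reducible unfolding sig_GB_below_def by meson
  have mon: "is_monomial a" "i \<in> {1..n}"
    and lt: "lead_term le (bar n g (Poly_Mapping.single i a)) = lead_term le (bar n g (u - v))"
    and sle: "sig_le lem (sig lem \<phi> (Poly_Mapping.single i a)) (sig lem \<phi> (u - v))"
    using ai by (auto simp: reduces_term_def)
  have free: "Poly_Mapping.single i a \<in> free_mod n" using mon(2) by (rule free_mod_single)
  \<comment> \<open>The step may be singular for \<open>u - v\<close>, but the signature of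
    \<open>u - v\<close> is below \<open>T\<close>, so the reducer is regular with respect to
    \<open>u\<close> and \<open>v\<close>.\<close>
  have "sig_less lem (sig lem \<phi> (Poly_Mapping.single i a)) (sig lem \<phi> u)"
    using less sle sig_le_trans[OF free uv u(1)] sig_le_trans[OF u(1) free uv] u(3)
    by (auto simp: sig_less_def)
  then have lessu: "sig_less lem (sig lem \<phi> (Poly_Mapping.single i a)) (sig lem \<phi> u)"
    "sig_less lem (sig lem \<phi> (Poly_Mapping.single i a)) (sig lem \<phi> v)"
    using u(3) v(3) by simp_all
  obtain s where s: "s \<in> Poly_Mapping.keys (bar n g (u - v))"
    "lead_term le (bar n g (u - v)) = Poly_Mapping.single s (Poly_Mapping.lookup (bar n g (u - v)) s)"
    using lead_termE[OF ne0] by metis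
  \<comment> \<open>The coefficient of \<open>s\<close> in \<open>u\<close> or \<open>v\<close> may
    differ from that in \<open>u - v\<close>, hence the rescaling below.\<close>
  have "s \<in> Poly_Mapping.keys (bar n g u) \<or> s \<in> Poly_Mapping.keys (bar n g v)"
    using s(1) keys_diff[of "bar n g u" "bar n g v"] by (auto simp: bar_diff)
  then show False
    using reg_reducer_rescaled[OF _ u(1) mon, of s] reg_reducer_rescaled[OF _ v(1) mon, of s]
      lt s(2) lessu u(2) v(2) unfolding regular_reduced_def by metis
qed

section \<open>Stability of lead terms, and monomials of a given signature\<close>

text \<open>Signature and lead term stay constant along the chain, so a later regular step at the
  lead term would already be available for \<open>u\<close>.\<close>

lemma regular_top_reduced_steps:
  assumes "(reg_step le lem n g \<phi>)\<^sup>*\<^sup>* u v" "u \<in> free_mod n" "bar n g u \<noteq> 0"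
    and "regular_top_reduced le lem n g \<phi> u"
  shows "bar n g v \<noteq> 0 \<and> lead_term le (bar n g v) = lead_term le (bar n g u)"
  using assms
proof (induction rule: rtranclp_induct)
  case (step v w)
  then have v: "bar n g v \<noteq> 0" "lead_term le (bar n g v) = lead_term le (bar n g u)" by auto
  obtain t a i where red: "reg_reduces_term le lem n g \<phi> v t a i"
    and w: "w = v - Poly_Mapping.single i a"
    using step.hyps(2) by (auto simp: reg_step_def)
  have sig: "sig lem \<phi> v = sig lem \<phi> u"
    using step.hyps(1) step.prems(1) reg_steps_free_mod_sig by blast
  have "\<exists>s\<in>Poly_Mapping.keys (bar n g u).
      lead_term le (bar n g u) = Poly_Mapping.single s (Poly_Mapping.lookup (bar n g u) s)"
    using lead_termE[OF step.prems(2)] by metis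
  then have "t \<noteq> lead_term le (bar n g v)"
    using red step.prems(2,3) unfolding regular_top_reducible_def v(2)
    by (auto simp: reg_reduces_term_def reduces_term_def sig)
  then show ?case
    using lead_term_red_step[of v t a i] red v(2) by (simp add: w reg_reduces_term_def)
qed simp

text \<open>The signature of \<open>a e_i\<close> is \<open>a\<close> times the nonzero signature of
  \<open>e_i\<close>. Prescribing it with its coefficient determines \<open>a\<close>, so each index
  contributes at most one element.\<close>

lemma monomials_of_sig_finite:
  "finite {Poly_Mapping.single i a | a i. is_monomial a \<and> i \<in> {1..n}
    \<and> sig lem \<phi> (Poly_Mapping.single i a) = T}"
proof -
  define A where "A i = {a. is_monomial a \<and> sig lem \<phi> (Poly_Mapping.single i a) = T}" for i
  have "a = b" if i: "i \<in> {1..n}" and ab: "a \<in> A i" "b \<in> A i" for i a b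
  proof -
    obtain t c where a: "a = Poly_Mapping.single t c" "c \<noteq> 0"
      using ab(1) by (auto simp: A_def is_monomial_def)
    obtain s d where b: "b = Poly_Mapping.single s d" "d \<noteq> 0"
      using ab(2) by (auto simp: A_def is_monomial_def)
    let ?e = "Poly_Mapping.single i (1 :: ('x, 'k) mpoly)"
    have e: "?e \<in> free_mod n" using i by (rule free_mod_single)
    have "is_monomial (1 :: ('x, 'k) mpoly)"
      unfolding is_monomial_def by (metis single_one one_neq_zero)
    then have "sig lem \<phi> ?e \<noteq> 0" using i by (rule sig_monomial_ne_0)
    then have "\<phi> ?e \<noteq> 0" by (auto simp: sig_def)
    then obtain t0 j c0 where sg: "sig lem \<phi> ?e = Poly_Mapping.single j (Poly_Mapping.single t0 c0)"
      "c0 \<noteq> 0"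
      using signatureE[OF phi_free_mod[OF e]] unfolding sig_def by metis
    have "sig lem \<phi> (Poly_Mapping.single i a) = Poly_Mapping.single j (Poly_Mapping.single (t + t0) (c * c0))"
      using sig_vscale_single[OF e a(2), of t] by (simp add: vscale_single sg a mult_single)
    moreover have "sig lem \<phi> (Poly_Mapping.single i b)
        = Poly_Mapping.single j (Poly_Mapping.single (s + t0) (d * c0))"
      using sig_vscale_single[OF e b(2), of s] by (simp add: vscale_single sg b mult_single)
    ultimately show ?thesis
      using ab single_single_eq_iff[of "c * c0" j "t + t0" j "s + t0" "d * c0"] sg(2) a b
      by (simp add: A_def)
  qed
  then have "\<exists>a. A i \<subseteq> {a}" if "i \<in> {1..n}" for i
    using that by blast
  then have "finite (A i)" if "i \<in> {1..n}" for i
    using that by (meson finite.emptyI finite.insertI finite_subset)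
  then have "finite (\<Union>i\<in>{1..n}. Poly_Mapping.single i ` A i)" by blast
  then show ?thesis by (rule rev_finite_subset) (auto simp: A_def)
qed

end

section \<open>The reduced S-pair compared with the elements of \<open>M\<close>\<close>

lemma regular_S_pair_free_mod: "regular_S_pair le lem n g \<phi> p \<Longrightarrow> p \<in> free_mod n"
  by (auto simp: regular_S_pair_def intro!: free_mod_diff free_mod_single)

theorem corollary5:
  fixes le :: "('x::finite) pp rel"
    and lem :: "('x pp \<times> nat) rel"
    and m n :: nat
    and g :: "nat \<Rightarrow> ('x, 'k::field) mpoly"
    and \<phi> :: "('x, 'k) mvec \<Rightarrow> ('x, 'k) mvec"
    and p p' :: "('x, 'k) mvec"
    and M :: "('x, 'k) mvec set"
  assumes "term_order le"
    and "module_term_order m lem"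
    and "compatible_orders m le lem"
    and "extension m n g \<phi>"
    and "regular_S_pair le lem n g \<phi> p"
    and "sig_GB_below le lem n g \<phi> (sig lem \<phi> p)"
    and "reg_reduces_to le lem n g \<phi> p p'"
    and M_def: "M = {Poly_Mapping.single i a | a i. is_monomial a \<and> i \<in> {1..n}
                      \<and> sig lem \<phi> (Poly_Mapping.single i a) = sig lem \<phi> p}"
  shows "finite M
    \<and> (\<forall>u\<in>M. (\<exists>r. reg_reduces_to le lem n g \<phi> u r)
             \<and> (\<forall>r. reg_reduces_to le lem n g \<phi> u r \<longrightarrow> bar n g r = bar n g p'))
    \<and> (singular_top_reducible le lem n g \<phi> p' \<longleftrightarrow>
         (\<exists>u\<in>M. regular_top_reduced le lem n g \<phi> u))"
proof -
  interpret signature_extension le lem m n g \<phi>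
    using assms(1,2,4) by unfold_locales
  have p: "p \<in> free_mod n" using assms(5) by (rule regular_S_pair_free_mod)
  have p': "p' \<in> free_mod n" "sig lem \<phi> p' = sig lem \<phi> p" "regular_reduced le lem n g \<phi> p'"
    using assms(7) p reg_steps_free_mod_sig by (auto simp: reg_reduces_to_def)
  have unique: "bar n g r = bar n g p'" if u: "u \<in> M" and r: "reg_reduces_to le lem n g \<phi> u r" for u r
  proof -
    have "u \<in> free_mod n" "sig lem \<phi> u = sig lem \<phi> p"
      using u by (auto simp: M_def free_mod_single)
    then have "r \<in> free_mod n" "sig lem \<phi> r = sig lem \<phi> p" "regular_reduced le lem n g \<phi> r"
      using r reg_steps_free_mod_sig by (auto simp: reg_reduces_to_def)
    then show ?thesis using regular_reduced_bar_eq p' assms(6) by blast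
  qed
  have "singular_top_reducible le lem n g \<phi> p'" if u: "u \<in> M" "regular_top_reduced le lem n g \<phi> u" for u
  proof -
    obtain a i where ai: "u = Poly_Mapping.single i a" "is_monomial a" "i \<in> {1..n}"
      "sig lem \<phi> u = sig lem \<phi> p"
      using u(1) by (auto simp: M_def)
    obtain r where r: "reg_reduces_to le lem n g \<phi> u r" using reg_reduces_to_exists by blast
    \<comment> \<open>The lead term of \<open>u\<close> survives reduction to \<open>r\<close>,
      whose image is that of \<open>p'\<close>; so \<open>u\<close> itself cancels the lead term of
      \<open>p'\<close>.\<close>
    have "bar n g r \<noteq> 0 \<and> lead_term le (bar n g r) = lead_term le (bar n g u)"
      using r u(2) ai(1) bar_monomial_ne_0[OF ai(2,3)] free_mod_single[OF ai(3), of a]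
      by (intro regular_top_reduced_steps) (auto simp: reg_reduces_to_def)
    then have lt: "bar n g p' \<noteq> 0" "lead_term le (bar n g p') = lead_term le (bar n g u)"
      using unique[OF u(1) r] by auto
    have "sig_le lem (sig lem \<phi> u) (sig lem \<phi> p')"
      unfolding ai(4) p'(2) unfolding sig_def
      by (rule sig_le_signature_refl[OF phi_free_mod[OF p]])
    moreover have "sig_sim (sig lem \<phi> u) (sig lem \<phi> p')"
      unfolding sig_sim_def ai(4) p'(2)
      by (intro exI[of _ 1]) (auto intro!: poly_mapping_eqI simp: lookup_vscale)
    moreover have "\<exists>s\<in>Poly_Mapping.keys (bar n g p'). lead_term le (bar n g p')
        = Poly_Mapping.single s (Poly_Mapping.lookup (bar n g p') s)"
      using lead_termE[OF lt(1)] by metis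
    ultimately have "sing_reduces_term le lem n g \<phi> p' (lead_term le (bar n g p')) a i"
      using ai lt(2) by (simp add: sing_reduces_term_def reduces_term_def)
    then show ?thesis using lt(1) by (auto simp: singular_top_reducible_def)
  qed
  moreover have "\<exists>u\<in>M. regular_top_reduced le lem n g \<phi> u"
    if sing: "singular_top_reducible le lem n g \<phi> p'"
  proof -
    obtain a i where ne: "bar n g p' \<noteq> 0"
      and red: "reduces_term le lem n g \<phi> p' (lead_term le (bar n g p')) a i"
      and sim: "sig_sim (sig lem \<phi> (Poly_Mapping.single i a)) (sig lem \<phi> p')"
      using sing unfolding singular_top_reducible_def sing_reduces_term_def by blast
    have mon: "is_monomial a" "i \<in> {1..n}"
      and lt: "lead_term le (bar n g (Poly_Mapping.single i a)) = lead_term le (bar n g p')"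
      using red by (auto simp: reduces_term_def)
    obtain c where c: "c \<noteq> 0"
      "sig lem \<phi> (Poly_Mapping.single i a) = vscale (Poly_Mapping.single 0 c) (sig lem \<phi> p)"
      using sim p'(2) by (auto simp: sig_sim_def)
    \<comment> \<open>A singular reducer has the signature of \<open>p\<close> only up to the
      constant \<open>c\<close>; membership in \<open>M\<close> requires equality, so
      \<open>c\<close> is divided out.\<close>
    define u where "u = vscale (Poly_Mapping.single 0 (inverse c)) (Poly_Mapping.single i a)"
    have u_single: "u = Poly_Mapping.single i (Poly_Mapping.single 0 (inverse c) * a)"
      by (simp add: u_def vscale_single)
    have "sig lem \<phi> u = vscale (Poly_Mapping.single 0 (inverse c))
        (vscale (Poly_Mapping.single 0 c) (sig lem \<phi> p))"
      unfolding u_def using c mon(2) by (simp add: sig_vscale_single free_mod_single)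
    also have "\<dots> = sig lem \<phi> p"
      using c(1) by (intro poly_mapping_eqI)
        (simp add: lookup_vscale mult.assoc[symmetric] mult_single)
    finally have sig_u: "sig lem \<phi> u = sig lem \<phi> p" .
    moreover have "is_monomial (Poly_Mapping.single 0 (inverse c) * a)"
      using mon(1) c(1) by (intro is_monomial_scale) simp_all
    ultimately have "u \<in> M"
      unfolding M_def mem_Collect_eq using mon(2) u_single by metis
    moreover have "regular_top_reduced le lem n g \<phi> u"
    proof
      assume "regular_top_reducible le lem n g \<phi> u"
      then obtain b j where bj: "reg_reduces_term le lem n g \<phi> u (lead_term le (bar n g u)) b j"
        by (auto simp: regular_top_reducible_def)
      obtain s where s: "s \<in> Poly_Mapping.keys (bar n g p')"
        "lead_term le (bar n g p') = Poly_Mapping.single s (Poly_Mapping.lookup (bar n g p') s)"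
        using lead_termE[OF ne] by metis
      \<comment> \<open>The lead terms of \<open>u\<close> and \<open>p'\<close> share the exponent
        \<open>s\<close>, so a regular reducer at the top of \<open>u\<close> rescales to one of
        \<open>p'\<close>, which is regular reduced.\<close>
      have "lead_term le (bar n g u)
          = Poly_Mapping.single s (inverse c * Poly_Mapping.lookup (bar n g p') s)"
        using c(1) by (simp add: u_def bar_vscale lead_term_scale lt s(2) mult_single)
      then have "lead_term le (bar n g (Poly_Mapping.single j b))
          = Poly_Mapping.single s (inverse c * Poly_Mapping.lookup (bar n g p') s)"
        "sig_less lem (sig lem \<phi> (Poly_Mapping.single j b)) (sig lem \<phi> p')"
        "is_monomial b" "j \<in> {1..n}"
        using bj by (auto simp: reg_reduces_term_def reduces_term_def sig_u p'(2))
      then show False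
        using reg_reducer_rescaled[OF s(1) p'(1)] p'(3) unfolding regular_reduced_def by blast
    qed
    ultimately show ?thesis by blast
  qed
  moreover have "finite M" unfolding M_def by (rule monomials_of_sig_finite)
  ultimately show ?thesis using reg_reduces_to_exists unique by blast
qed

end
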